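(* Let $H\in\mathbb{R}^{n\times n}$ be symmetric with eigenvalues $\lambda_1\ge\dots\ge\lambda_n$ and orthonormal eigenvectors $u_1,\dots,u_n$, let $g\in\mathbb{R}^n$ with $g\neq0$, and $M>0$. For $\lambda>\max\{0,-\lambda_n\}$ let $\varphi(\lambda)=\|(H+\lambda I)^{-1}g\|$. Let $\lambda^\star$ be a solution, in the domain $\lambda>\max\{0,-\lambda_n\}$, of the secular equation $\lambda=\tfrac{M}{2}\varphi(\lambda)$, and let $r^\star=\varphi(\lambda^\star)$. Then $$r^\star\ge\frac{2\max\{0,-\lambda_n\}}{M},$$ and consequently the shifted operator $H+\tfrac{Mr^\star}{2}I$ is positive semidefinite. It is positive definite whenever $\lambda^\star>-\lambda_n$, and this holds in the non-degenerate case, i.e. when $\langle u_n,g\rangle\ne0$ or $\lambda_n\ge0$.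
   Context: $\|\cdot\|$ is the Euclidean norm. In the non-degenerate case ($\langle u_n,g\rangle\neq0$ or $\lambda_n\ge0$) it is known that the secular equation has a unique solution $\lambda^\star>\max\{0,-\lambda_n\}$. *)

theory Defs
  imports "HOL-Analysis.Analysis"
begin

definition symmetric_matrix :: "real^'n^'n \<Rightarrow> bool" where
  "symmetric_matrix A \<longleftrightarrow> transpose A = A"

definition pos_semidefinite :: "real^'n^'n \<Rightarrow> bool" where
  "pos_semidefinite A \<longleftrightarrow> symmetric_matrix A \<and> (\<forall>x. x \<bullet> (A *v x) \<ge> 0)"

definition pos_definite :: "real^'n^'n \<Rightarrow> bool" where
  "pos_definite A \<longleftrightarrow> symmetric_matrix A \<and> (\<forall>x. x \<noteq> 0 \<longrightarrow> x \<bullet> (A *v x) > 0)"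

(* lam 1 >= ... >= lam n and u 1, ..., u n, with n = CARD('n).  Since the n orthonormal
   vectors form a basis of real^'n, lam lists the eigenvalues with multiplicity.
   Values of lam and u outside {1..n} are irrelevant. *)
definition ordered_eigensystem ::
  "real^'n^'n \<Rightarrow> (nat \<Rightarrow> real) \<Rightarrow> (nat \<Rightarrow> real^'n) \<Rightarrow> bool" where
  "ordered_eigensystem H lam u \<longleftrightarrow>
     (\<forall>i\<in>{1..CARD('n)}. H *v u i = lam i *\<^sub>R u i) \<and>
     (\<forall>i\<in>{1..CARD('n)}. \<forall>j\<in>{1..CARD('n)}. u i \<bullet> u j = (if i = j then 1 else 0)) \<and>
     (\<forall>i\<in>{1..CARD('n)}. \<forall>j\<in>{1..CARD('n)}. i \<le> j \<longrightarrow> lam j \<le> lam i)"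

(* Here mat l is l times the identity.  matrix_inv is unspecified on singular matrices, so
   this is meaningful only where H + mat l is invertible, in particular for
   l > max 0 (- lam n). *)
definition secular_phi :: "real^'n^'n \<Rightarrow> real^'n \<Rightarrow> real \<Rightarrow> real" where
  "secular_phi H g l = norm (matrix_inv (H + mat l) *v g)"

end

theory Submission
  imports Defs
begin

text \<open>The secular equation says exactly that \<open>M * rstar / 2 = lstar\<close>, so the
  shifted operator in question is \<open>H + mat lstar\<close>. Membership of \<open>lstar\<close>
  in the domain then gives everything: \<open>lstar > max 0 (- lam n)\<close> rescaled by
  \<open>2 / M\<close> is the bound on \<open>rstar\<close>, and \<open>lstar > - lam n\<close>
  moves the whole spectrum of \<open>H\<close> above zero. The second point rests on the Rayleigh
  bound \<open>rayleigh_lower_bound\<close>, obtained by expanding a vector in the orthonormal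
  eigenbasis (\<open>orthonormal_family_expansion\<close>); \<open>pos_definite_shift\<close> draws
  the conclusion.\<close>

lemma orthonormal_family_span:
  fixes u :: "'i \<Rightarrow> real^'n"
  assumes card: "card I = CARD('n)"
    and on: "\<And>i j. i \<in> I \<Longrightarrow> j \<in> I \<Longrightarrow> u i \<bullet> u j = (if i = j then 1 else 0)"
  shows "span (u ` I) = UNIV"
proof -
  \<comment> \<open>Injectivity guarantees that the image has \<open>CARD('n)\<close> elements: two
    equal vectors with distinct indices would have inner product both 1 and 0.\<close>
  have inj: "inj_on u I"
  proof (rule inj_onI)
    fix i j
    assume "i \<in> I" "j \<in> I" "u i = u j"
    then show "i = j"
      using on[of i i] on[of i j] by (simp split: if_splits)
  qed
  have "pairwise orthogonal (u ` I)"
    using on by (auto simp: pairwise_def orthogonal_def)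
  moreover have "0 \<notin> u ` I"
    using on by force
  ultimately have "independent (u ` I)"
    by (rule pairwise_orthogonal_independent)
  \<comment> \<open>An independent set with as many elements as the dimension spans the
    space.\<close>
  then have "UNIV \<subseteq> span (u ` I)"
    by (intro card_ge_dim_independent) (simp_all add: card_image[OF inj] card)
  then show ?thesis
    by blast
qed

text \<open>The residual \<open>x - s\<close> is orthogonal to every \<open>u j\<close>, hence to
  their span. That span is the whole space, so the residual is orthogonal to itself and
  vanishes.\<close>

lemma orthonormal_family_expansion:
  fixes u :: "'i \<Rightarrow> real^'n"
  assumes fin: "finite I" and card: "card I = CARD('n)"
    and on: "\<And>i j. i \<in> I \<Longrightarrow> j \<in> I \<Longrightarrow> u i \<bullet> u j = (if i = j then 1 else 0)"
  shows "(\<Sum>i\<in>I. (u i \<bullet> x) *\<^sub>R u i) = x"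
proof -
  define s where "s = (\<Sum>i\<in>I. (u i \<bullet> x) *\<^sub>R u i)"
  have "orthogonal (x - s) v" if "v \<in> u ` I" for v
  proof -
    from that obtain j where j: "j \<in> I" "v = u j"
      by blast
    have "s \<bullet> u j = (\<Sum>i\<in>I. (u i \<bullet> x) * (u i \<bullet> u j))"
      by (simp add: s_def inner_sum_left)
    also have "\<dots> = (\<Sum>i\<in>I. if i = j then u i \<bullet> x else 0)"
      using on j by (intro sum.cong) simp_all
    also have "\<dots> = x \<bullet> u j"
      using fin j by (simp add: inner_commute)
    finally show ?thesis
      by (simp add: orthogonal_def inner_diff_left j)
  qed
  moreover have "x - s \<in> span (u ` I)"
    using orthonormal_family_span[OF card on] by simp
  ultimately have "orthogonal (x - s) (x - s)"
    by (rule orthogonal_to_span[rotated])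
  then show ?thesis
    unfolding orthogonal_def inner_eq_zero_iff right_minus_eq s_def by (rule sym)
qed

text \<open>In eigenbasis coordinates both sides are weighted sums of the squares
  \<open>(u i \<bullet> x)\<^sup>2\<close>, with weights \<open>lam CARD('n)\<close> and
  \<open>lam i\<close>; the last eigenvalue is the smallest.\<close>

lemma rayleigh_lower_bound:
  fixes H :: "real^'n^'n"
  assumes "ordered_eigensystem H lam u"
  shows "lam CARD('n) * (x \<bullet> x) \<le> x \<bullet> (H *v x)"
proof -
  let ?I = "{1..CARD('n)}"
  have eig: "H *v u i = lam i *\<^sub>R u i" if "i \<in> ?I" for i
    using assms that by (simp add: ordered_eigensystem_def)
  have ge: "lam CARD('n) \<le> lam i" if "i \<in> ?I" for i
    using assms that by (simp add: ordered_eigensystem_def Suc_le_eq)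
  have expand: "(\<Sum>i\<in>?I. (u i \<bullet> x) *\<^sub>R u i) = x"
    by (rule orthonormal_family_expansion)
      (use assms in \<open>simp_all add: ordered_eigensystem_def\<close>)
  \<comment> \<open>Only one factor is expanded: pairing \<open>u i\<close> with the intact
    \<open>x\<close> gives the coefficient a second time, so the squares appear without a double
    sum.\<close>
  have "x \<bullet> x = x \<bullet> (\<Sum>i\<in>?I. (u i \<bullet> x) *\<^sub>R u i)"
    by (simp only: expand)
  then have xx: "x \<bullet> x = (\<Sum>i\<in>?I. (u i \<bullet> x)\<^sup>2)"
    by (simp add: inner_sum_right inner_commute power2_eq_square)
  have "H *v x = H *v (\<Sum>i\<in>?I. (u i \<bullet> x) *\<^sub>R u i)"
    by (simp only: expand)
  also have "\<dots> = (\<Sum>i\<in>?I. (u i \<bullet> x) *\<^sub>R lam i *\<^sub>R u i)"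
    by (simp add: linear_sum[OF matrix_vector_mul_linear] matrix_vector_mult_scaleR eig)
  finally have "x \<bullet> (H *v x) = (\<Sum>i\<in>?I. lam i * (u i \<bullet> x)\<^sup>2)"
    by (simp add: inner_sum_right inner_commute power2_eq_square ac_simps)
  moreover have "(\<Sum>i\<in>?I. lam CARD('n) * (u i \<bullet> x)\<^sup>2) \<le> (\<Sum>i\<in>?I. lam i * (u i \<bullet> x)\<^sup>2)"
    by (intro sum_mono mult_right_mono ge) simp_all
  ultimately show ?thesis
    by (simp add: xx sum_distrib_left)
qed

lemma mat_vector_mult: "mat c *v x = c *\<^sub>R (x :: real^'n)"
  by (simp add: vec_eq_iff matrix_vector_mult_def mat_def if_distrib if_distribR
      cong del: if_weak_cong)

lemma symmetric_matrix_add_mat: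
  "symmetric_matrix H \<Longrightarrow> symmetric_matrix (H + mat c)"
  by (auto simp: symmetric_matrix_def transpose_def mat_def vec_eq_iff)

text \<open>The Rayleigh bound leaves the margin \<open>lam CARD('n) + l > 0\<close> in front of
  \<open>x \<bullet> x\<close>.\<close>

lemma pos_definite_shift:
  fixes H :: "real^'n^'n"
  assumes "symmetric_matrix H" and "ordered_eigensystem H lam u" and "l > - lam CARD('n)"
  shows "pos_definite (H + mat l)"
  unfolding pos_definite_def
proof (intro conjI allI impI symmetric_matrix_add_mat assms)
  fix x :: "real^'n"
  assume "x \<noteq> 0"
  then have "0 < (lam CARD('n) + l) * (x \<bullet> x)"
    using assms(3) by simp
  also have "\<dots> \<le> x \<bullet> (H *v x) + l * (x \<bullet> x)"
    using rayleigh_lower_bound[OF assms(2)] by (simp add: algebra_simps)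
  also have "\<dots> = x \<bullet> ((H + mat l) *v x)"
    by (simp add: matrix_vector_mult_add_rdistrib mat_vector_mult inner_add_right)
  finally show "0 < x \<bullet> ((H + mat l) *v x)" .
qed

lemma pos_definite_imp_pos_semidefinite: "pos_definite A \<Longrightarrow> pos_semidefinite A"
  unfolding pos_definite_def pos_semidefinite_def
proof (elim conjE, intro conjI allI)
  fix x
  assume "\<forall>x. x \<noteq> 0 \<longrightarrow> 0 < x \<bullet> (A *v x)"
  then show "0 \<le> x \<bullet> (A *v x)"
    by (cases "x = 0") (simp_all add: less_imp_le)
qed

theorem lemma3p2:
  fixes H :: "real^'n^'n" and g :: "real^'n" and M :: real
    and lam :: "nat \<Rightarrow> real" and u :: "nat \<Rightarrow> real^'n" and n :: nat
    and lstar rstar :: real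
  assumes "n = CARD('n)"
    and "symmetric_matrix H"
    and "ordered_eigensystem H lam u"
    and "g \<noteq> 0"
    and "M > 0"
    and "lstar > max 0 (- lam n)"
    and "lstar = M / 2 * secular_phi H g lstar"
    and "rstar = secular_phi H g lstar"
  shows "rstar \<ge> 2 * max 0 (- lam n) / M
    \<and> pos_semidefinite (H + mat (M * rstar / 2))
    \<and> (lstar > - lam n \<longrightarrow> pos_definite (H + mat (M * rstar / 2)))
    \<and> (u n \<bullet> g \<noteq> 0 \<or> lam n \<ge> 0 \<longrightarrow>
         lstar > - lam n \<and> pos_definite (H + mat (M * rstar / 2)))"
proof -
  have shift: "M * rstar / 2 = lstar"
    using assms(7,8) by simp
  have gt: "lstar > - lam n"
    using assms(6) by simp
  \<comment> \<open>After multiplication by \<open>M > 0\<close> the right side is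
    \<open>2 * lstar\<close>, so this is the domain condition on \<open>lstar\<close>.\<close>
  have "2 * max 0 (- lam n) / M \<le> rstar"
    using assms(5,6) shift by (simp add: pos_divide_le_eq mult.commute)
  moreover have "pos_definite (H + mat lstar)"
    using pos_definite_shift assms(1-3) gt by blast
  ultimately show ?thesis
    using gt pos_definite_imp_pos_semidefinite by (simp add: shift)
qed

end
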